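(* The fixed point $z=1$ of $O_p$ satisfies the following statements: (i) If $\left|\alpha-\frac{13}{6}\right|<\frac13$, then $z=1$ is an attractor and, in particular, it is a superattractor for $\alpha=2$. (ii) If $\left|\alpha-\frac{13}{6}\right|=\frac13$, then $z=1$ is a parabolic point. (iii) If $\left|\alpha-\frac{13}{6}\right|>\frac13$, then $z=1$ is a repulsive fixed point.
   Context: Let $\alpha$ be a complex parameter and let $O_p$ be the rational map of the Riemann sphere $\hat{\mathbb{C}}$ given by $$O_p(z)=z^3\,\frac{z-2(\alpha-1)}{1-2(\alpha-1)z}.$$ It arises as follows. The Chebyshev-Halley iteration with parameter $\alpha$ for solving $f(z)=0$ has the fixed point operator $$G(z)=z-\left(1+\frac12\,\frac{L_f(z)}{1-\alpha L_f(z)}\right)\frac{f(z)}{f'(z)},\qquad L_f(z)=\frac{f(z)f''(z)}{(f'(z))^2}.$$ Applying it to the quadratic polynomial $p(z)=z^2+c$ gives an operator $G_p$, and $O_p=h\circ G_p\circ h^{-1}$ with $h(z)=\frac{z-i\sqrt c}{z+i\sqrt c}$; the parameter $c$ does not appear in $O_p$. A fixed point $z_0$ of a rational map $R$ (i.e. $R(z_0)=z_0$) is called an attractor (attractive) if $|R'(z_0)|<1$, a superattractor if $|R'(z_0)|=0$, a repulsor (repulsive) if $|R'(z_0)|>1$, and parabolic if $|R'(z_0)|=1$.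
   Formalization: Part (iii) is stated for α ≠ 3/2, because at α = 3/2 the map O_p reduces to −z³, so z = 1 is not a fixed point although |α − 13/6| = 2/3 > 1/3. *)

theory Defs
  imports
    "HOL-Complex_Analysis.Complex_Analysis"
    "HOL-Computational_Algebra.Field_as_Ring"
    "HOL-Computational_Algebra.Polynomial_Factorial"
begin

(* The Riemann sphere: None is the point at infinity. *)
type_synonym sphere = "complex option"

(* The self-map of the sphere induced by the rational function P / Q (with Q nonzero). Common
   factors are cancelled first, so the map is the continuous one, with no indeterminate 0/0.
   The value at infinity is the quotient of the coefficients in the common degree max (deg p) (deg q),
   which is p / q evaluated in homogeneous coordinates at [1 : 0]. *)
definition rational_map :: "complex poly \<Rightarrow> complex poly \<Rightarrow> sphere \<Rightarrow> sphere" where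
  "rational_map P Q z =
    (let p = P div gcd P Q; q = Q div gcd P Q; d = max (degree p) (degree q) in
     case z of
       Some w \<Rightarrow> if poly q w = 0 then None else Some (poly p w / poly q w)
     | None \<Rightarrow> if coeff q d = 0 then None else Some (coeff p d / coeff q d))"

fun sphere_inverse :: "sphere \<Rightarrow> sphere" where
  "sphere_inverse None = Some 0"
| "sphere_inverse (Some w) = (if w = 0 then None else Some (1 / w))"

definition fixed_point :: "(sphere \<Rightarrow> sphere) \<Rightarrow> sphere \<Rightarrow> bool" where
  "fixed_point R z \<longleftrightarrow> R z = z"

(* The derivative R'(z) at a fixed point z of R. At a finite fixed point R is finite nearby, so "the" only meets
   None away from z; at infinity the derivative is taken in the chart 1/z, as usual. *)
definition multiplier :: "(sphere \<Rightarrow> sphere) \<Rightarrow> sphere \<Rightarrow> complex" where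
  "multiplier R z =
    (case z of
       Some w \<Rightarrow> deriv (\<lambda>u. the (R (Some u))) w
     | None \<Rightarrow> deriv (\<lambda>u. the (sphere_inverse (R (sphere_inverse (Some u))))) 0)"

definition attractor :: "(sphere \<Rightarrow> sphere) \<Rightarrow> sphere \<Rightarrow> bool" where
  "attractor R z \<longleftrightarrow> fixed_point R z \<and> norm (multiplier R z) < 1"

definition superattractor :: "(sphere \<Rightarrow> sphere) \<Rightarrow> sphere \<Rightarrow> bool" where
  "superattractor R z \<longleftrightarrow> fixed_point R z \<and> norm (multiplier R z) = 0"

definition repulsor :: "(sphere \<Rightarrow> sphere) \<Rightarrow> sphere \<Rightarrow> bool" where
  "repulsor R z \<longleftrightarrow> fixed_point R z \<and> norm (multiplier R z) > 1"

definition parabolic :: "(sphere \<Rightarrow> sphere) \<Rightarrow> sphere \<Rightarrow> bool" where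
  "parabolic R z \<longleftrightarrow> fixed_point R z \<and> norm (multiplier R z) = 1"

(* z^3 (z - 2(alpha - 1)) / (1 - 2(alpha - 1) z). For alpha = 3/2 this is the map -z^3, which does
   not fix 1. *)
definition O_p :: "complex \<Rightarrow> sphere \<Rightarrow> sphere" where
  "O_p \<alpha> = rational_map ([:0, 1:] ^ 3 * [:- (2 * (\<alpha> - 1)), 1:]) [:1, - (2 * (\<alpha> - 1)):]"

end

theory Submission
  imports Defs
begin

text \<open>For \<open>\<alpha> \<noteq> 3 / 2\<close> the point 1 is fixed with multiplier
  4(\<alpha> - 2)/(2\<alpha> - 3) (\<open>multiplier_O_p_1\<close>), a Moebius function of \<alpha>
  vanishing at 2. By \<open>norm_multiplier_O_p_1\<close>, its squared modulus minus 1 is a positive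
  multiple of |\<alpha> - 13/6|^2 - 1/9, so comparing the multiplier with the unit circle amounts to
  comparing \<alpha> with the circle of centre 13/6 and radius 1/3.\<close>

text \<open>The gcd divides \<open>Q\<close>, so it cannot vanish where \<open>Q\<close> does not,
  and cancelling it leaves the quotient of values unchanged.\<close>

lemma rational_map_finite:
  assumes "poly Q w \<noteq> 0"
  shows "rational_map P Q (Some w) = Some (poly P w / poly Q w)"
proof -
  define g where "g = gcd P Q"
  have P: "poly P w = poly (P div g) w * poly g w"
    by (metis dvd_div_mult_self g_def gcd_dvd1 poly_mult)
  have Q: "poly Q w = poly (Q div g) w * poly g w"
    by (metis dvd_div_mult_self g_def gcd_dvd2 poly_mult)
  show ?thesis
    using assms P Q by (simp add: rational_map_def Let_def g_def[symmetric])
qed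

text \<open>The quotient formula holds on the whole open set where \<open>Q\<close> is nonzero, so
  the quotient rule applies at \<open>w\<close>.\<close>

lemma multiplier_rational_map_finite:
  assumes "poly Q w \<noteq> 0"
  shows "multiplier (rational_map P Q) (Some w) =
    (poly (pderiv P) w * poly Q w - poly P w * poly (pderiv Q) w) / (poly Q w)\<^sup>2"
proof -
  have "open {u. poly Q u \<noteq> 0}"
    by (intro open_Collect_neq continuous_intros)
  moreover have "((\<lambda>u. poly P u / poly Q u) has_field_derivative
    (poly (pderiv P) w * poly Q w - poly P w * poly (pderiv Q) w) / (poly Q w)\<^sup>2) (at w)"
    using assms by (auto intro!: derivative_eq_intros simp: power2_eq_square)
  ultimately have "((\<lambda>u. the (rational_map P Q (Some u))) has_field_derivative
    (poly (pderiv P) w * poly Q w - poly P w * poly (pderiv Q) w) / (poly Q w)\<^sup>2) (at w)"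
    using assms by (elim has_field_derivative_transform_within_open)
      (auto simp: rational_map_finite)
  then show ?thesis
    by (simp add: multiplier_def DERIV_imp_deriv)
qed

lemma fixed_point_O_p_1:
  assumes "\<alpha> \<noteq> 3 / 2"
  shows "fixed_point (O_p \<alpha>) (Some 1)"
  using assms by (simp add: fixed_point_def O_p_def rational_map_finite field_simps)

lemma multiplier_O_p_1:
  assumes "\<alpha> \<noteq> 3 / 2"
  shows "multiplier (O_p \<alpha>) (Some 1) = 4 * (\<alpha> - 2) / (2 * \<alpha> - 3)"
proof -
  have nz: "3 - 2 * \<alpha> \<noteq> 0" "2 * \<alpha> - 3 \<noteq> 0"
    using assms by (auto simp: field_simps)
  \<comment> \<open>With s = 3 - 2\<alpha>, numerator and denominator both take the value s at 1;
    their derivatives there are 3s + 1 and -2(\<alpha> - 1).\<close>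
  have "multiplier (O_p \<alpha>) (Some 1) =
      ((3 * (3 - 2 * \<alpha>) + 1) * (3 - 2 * \<alpha>) + (3 - 2 * \<alpha>) * (2 * (\<alpha> - 1))) / (3 - 2 * \<alpha>)\<^sup>2"
    unfolding O_p_def using nz
    by (subst multiplier_rational_map_finite)
      (simp_all add: pderiv_mult pderiv_power pderiv_pCons power2_eq_square power3_eq_cube
        algebra_simps)
  also have "\<dots> = 4 * (\<alpha> - 2) / (2 * \<alpha> - 3)"
    using nz by (simp add: divide_simps power2_eq_square) (simp add: algebra_simps)
  finally show ?thesis .
qed

text \<open>The unit circle of the multiplier pulls back to the Apollonius circle
  $4 |\alpha - 2| = |2 \alpha - 3|$, which has centre $13/6$ and radius $1/3$.\<close>

lemma norm_multiplier_O_p_1: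
  assumes "\<alpha> \<noteq> 3 / 2"
  shows "(norm (multiplier (O_p \<alpha>) (Some 1)))\<^sup>2 - 1 =
    12 * ((norm (\<alpha> - 13 / 6))\<^sup>2 - (1 / 3)\<^sup>2) / (norm (2 * \<alpha> - 3))\<^sup>2"
proof -
  have nz: "norm (2 * \<alpha> - 3) \<noteq> 0"
    using assms by (auto simp: field_simps)
  \<comment> \<open>Completing the square: both sides equal 12|\<alpha>|^2 - 52 Re \<alpha> +
    55.\<close>
  have key: "16 * (norm (\<alpha> - 2))\<^sup>2 - (norm (2 * \<alpha> - 3))\<^sup>2 =
      12 * ((norm (\<alpha> - 13 / 6))\<^sup>2 - (1 / 3)\<^sup>2)"
    unfolding cmod_power2 by (simp add: power2_eq_square algebra_simps)
  have "(norm (multiplier (O_p \<alpha>) (Some 1)))\<^sup>2 =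
      16 * (norm (\<alpha> - 2))\<^sup>2 / (norm (2 * \<alpha> - 3))\<^sup>2"
    unfolding multiplier_O_p_1[OF assms] norm_mult norm_divide power_divide power_mult_distrib
    by simp
  then show ?thesis
    unfolding key[symmetric] using nz by (simp add: diff_divide_distrib)
qed

theorem proposition1:
  fixes \<alpha> :: complex
  shows "(norm (\<alpha> - 13 / 6) < 1 / 3 \<longrightarrow> attractor (O_p \<alpha>) (Some 1)) \<and>
    (\<alpha> = 2 \<longrightarrow> superattractor (O_p \<alpha>) (Some 1)) \<and>
    (norm (\<alpha> - 13 / 6) = 1 / 3 \<longrightarrow> parabolic (O_p \<alpha>) (Some 1)) \<and>
    (norm (\<alpha> - 13 / 6) > 1 / 3 \<and> \<alpha> \<noteq> 3 / 2 \<longrightarrow> repulsor (O_p \<alpha>) (Some 1))"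
proof (cases "\<alpha> = 3 / 2")
  case True
  \<comment> \<open>This parameter lies outside the closed disc and differs from 2, so every premise
    fails.\<close>
  have "\<alpha> - 13 / 6 = - (2 / 3)"
    unfolding True by simp
  then have "norm (\<alpha> - 13 / 6) = 2 / 3"
    by (simp only: norm_minus_cancel norm_divide norm_numeral)
  then show ?thesis
    unfolding True by simp
next
  case False
  define m where "m = norm (multiplier (O_p \<alpha>) (Some 1))"
  define r where "r = norm (\<alpha> - 13 / 6)"
  have pos: "(norm (2 * \<alpha> - 3))\<^sup>2 > 0"
    using False by (auto simp: field_simps)
  have eq: "m\<^sup>2 - 1\<^sup>2 = 12 * (r\<^sup>2 - (1 / 3)\<^sup>2) / (norm (2 * \<alpha> - 3))\<^sup>2"
    unfolding m_def r_def using norm_multiplier_O_p_1[OF False] by simp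
  have "m \<ge> 0" "r \<ge> 0"
    by (simp_all add: m_def r_def)
  have lt: "m < 1 \<longleftrightarrow> r < 1 / 3"
  proof -
    have "m < 1 \<longleftrightarrow> m\<^sup>2 - 1\<^sup>2 < 0"
      using \<open>m \<ge> 0\<close> by (simp add: abs_square_less_1)
    also have "\<dots> \<longleftrightarrow> r\<^sup>2 < (1 / 3)\<^sup>2"
      unfolding eq using pos by (simp add: divide_less_0_iff)
    also have "\<dots> \<longleftrightarrow> r < 1 / 3"
      using power_mono_iff[of "1 / 3" r 2] \<open>r \<ge> 0\<close> by (simp flip: not_le)
    finally show ?thesis .
  qed
  have one: "m = 1 \<longleftrightarrow> r = 1 / 3"
  proof -
    have "m = 1 \<longleftrightarrow> m\<^sup>2 - 1\<^sup>2 = 0"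
      using \<open>m \<ge> 0\<close> by (simp add: power2_eq_1_iff)
    also have "\<dots> \<longleftrightarrow> r\<^sup>2 = (1 / 3)\<^sup>2"
      unfolding eq using pos by simp
    also have "\<dots> \<longleftrightarrow> r = 1 / 3"
      using \<open>r \<ge> 0\<close> by (intro power2_eq_iff_nonneg) auto
    finally show ?thesis .
  qed
  have super: "multiplier (O_p \<alpha>) (Some 1) = 0" if "\<alpha> = 2"
    using multiplier_O_p_1[OF False] that by simp
  \<comment> \<open>The repulsive case follows by trichotomy from \<open>lt\<close> and
    \<open>one\<close>.\<close>
  show ?thesis
    using fixed_point_O_p_1[OF False] lt one super
    by (auto simp: attractor_def superattractor_def parabolic_def repulsor_def
        m_def[symmetric] r_def[symmetric])
qed

end
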